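(* Let $m,n,p$ be integers with $3\leq m\leq n$ and $(m-1)(n-1)+1\leq p\leq(m-1)n$. Any typical rank of $\mathbb{R}^{n\times p\times m}$ is less than or equal to $p+1$.
   Context: $\mathbb{R}^{n\times p\times m}$ is the space of real $n\times p\times m$ tensors with the Euclidean topology. The rank of a tensor $T$ is the minimal $r$ such that $T$ is a sum of $r$ tensors of the form $\mathbf{a}\otimes\mathbf{b}\otimes\mathbf{c}$ with $\mathbf{a}\in\mathbb{R}^n$, $\mathbf{b}\in\mathbb{R}^p$, $\mathbf{c}\in\mathbb{R}^m$. An integer $r$ is a typical rank if the set of tensors of rank $r$ contains a nonempty open subset. *)

theory Defs
  imports "HOL-Analysis.Analysis"
begin

(* An n x p x m tensor is an element T of real^'m^'p^'n with n = CARD('n), p = CARD('p),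
   m = CARD('m); its (i,j,k) entry is T $ i $ j $ k. The library topology on this type is
   the Euclidean one. *)

definition tensor_prod3 ::
  "real^'n \<Rightarrow> real^'p \<Rightarrow> real^'m \<Rightarrow> real^'m^'p^'n"
  where "tensor_prod3 a b c = (\<chi> i j k. a $ i * b $ j * c $ k)"

definition rank_decomposition ::
  "real^'m^'p^'n \<Rightarrow> nat \<Rightarrow> bool"
  where "rank_decomposition T r \<longleftrightarrow>
    (\<exists>(a :: nat \<Rightarrow> real^'n) (b :: nat \<Rightarrow> real^'p) (c :: nat \<Rightarrow> real^'m).
       T = (\<Sum>l<r. tensor_prod3 (a l) (b l) (c l)))"

definition tensor_rank :: "real^'m^'p^'n \<Rightarrow> nat"
  where "tensor_rank T = (LEAST r. rank_decomposition T r)"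

(* The minimum defining the rank is over a nonempty set. *)
lemma rank_decomposition_exists:
  fixes T :: "real^'m^'p^'n"
  shows "\<exists>r. rank_decomposition T r"
proof -
  let ?I = "UNIV :: ('n \<times> 'p \<times> 'm) set"
  obtain h where h: "bij_betw h {..<card ?I} ?I"
    using ex_bij_betw_nat_finite[of ?I] by (auto simp: atLeast0LessThan)
  define t :: "'n \<times> 'p \<times> 'm \<Rightarrow> real^'m^'p^'n" where
    "t x = tensor_prod3 (axis (fst x) 1) (axis (fst (snd x)) 1)
             (axis (snd (snd x)) (T $ fst x $ fst (snd x) $ snd (snd x)))" for x
  have "T = (\<Sum>x\<in>?I. t x)"
  proof (intro vec_eq_iff[THEN iffD2] allI)
    fix i j k
    have "(\<Sum>x\<in>?I. t x) $ i $ j $ k = (\<Sum>x\<in>?I. if x = (i, j, k) then T $ i $ j $ k else 0)"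
      unfolding sum_component
      by (rule sum.cong) (auto simp: t_def tensor_prod3_def axis_def)
    then show "T $ i $ j $ k = (\<Sum>x\<in>?I. t x) $ i $ j $ k"
      by simp
  qed
  also have "\<dots> = (\<Sum>l<card ?I. t (h l))"
    by (rule sum.reindex_bij_betw[OF h, symmetric])
  finally show ?thesis
    unfolding rank_decomposition_def t_def
    by (intro exI[of _ "card ?I"]
          exI[of _ "\<lambda>l. axis (fst (h l)) 1"]
          exI[of _ "\<lambda>l. axis (fst (snd (h l))) 1"]
          exI[of _ "\<lambda>l. axis (snd (snd (h l))) (T $ fst (h l) $ fst (snd (h l)) $ snd (snd (h l)))"])
qed

definition typical_rank :: "(real^'m^'p^'n) itself \<Rightarrow> nat \<Rightarrow> bool"
  where "typical_rank S r \<longleftrightarrow>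
    (\<exists>U :: (real^'m^'p^'n) set. open U \<and> U \<noteq> {} \<and> U \<subseteq> {T. tensor_rank T = r})"

end

theory Submission
  imports Defs "HOL-Library.Landau_Symbols"
begin

text \<open>
  It suffices that every nonempty open set of tensors contains one of rank at most \<open>p + 1\<close>.
  View a tensor \<open>T\<close> as \<open>p\<close> slices, which are \<open>n \<times> m\<close> matrices; if the slices lie in the span
  of \<open>r\<close> rank one matrices, then \<open>T\<close> has rank at most \<open>r\<close>.

  Let \<open>E\<close> be the matrix unit at a fixed base position \<open>(i0, j0)\<close>, and let \<open>W\<close> be the span of \<open>E\<close>
  and the slices. For generic \<open>T\<close> the space \<open>W\<close> has dimension \<open>p + 1\<close>, and \<open>W\<close> meets the variety of
  rank one matrices at its real point \<open>E\<close> in positive dimension. So there is a real curve of rank one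
  matrices in \<open>W\<close> through \<open>E\<close>, and for generic \<open>T\<close> this curve spans \<open>W\<close> together with \<open>E\<close>. Then all
  slices are combinations of \<open>E\<close> and \<open>p\<close> points of the curve. Adding \<open>E\<close>, which costs the one extra
  rank, is what guarantees a real point to start the curve from.

  In detail, choose \<open>p\<close> core positions (the range of \<open>\<sigma>\<close>) such that all positions outside the row and
  the column of the base are core. Generically \<open>W\<close>, modulo \<open>E\<close>, is the graph of a linear map with
  coefficients \<open>B\<close> from the core entries \<open>w\<close> to all entries (\<open>tensor_near_in_graph\<close>). A matrix of
  \<open>W\<close> with entry \<open>1\<close> at the base has rank one iff each core entry outside the base row and
  column is the product of the two entries that share its row and column with the base
  (\<open>rank_one_entry\<close>). The core entries within the base row or column are free; setting them to powers of
  a parameter \<open>t\<close> leaves a quadratic fixed point equation for \<open>w\<close>. Brouwer's theorem solves it for all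
  small \<open>t > 0\<close> with \<open>w = O(t)\<close> (\<open>solution_curve_exists\<close>). Since the equation is quadratic, iterating
  it from \<open>0\<close> gives polynomials in \<open>t\<close> that approximate any such solution to any order
  (\<open>solution_curve_jet\<close>). Therefore the curve spans \<open>\<real>\<^sup>p\<close> as soon as a certain \<open>p \<times> p\<close> matrix of
  Taylor coefficients is invertible (\<open>span_solution_curve\<close>).

  The determinant of that matrix is a polynomial in \<open>B\<close>. Restricted to the line from the given \<open>B\<close> to a
  special one it is a nonzero polynomial in one variable, so an arbitrarily small change of \<open>B\<close> makes it
  nonzero (\<open>rank_decomposition_near\<close>). The special coefficients are those of a monomial curve: entry
  \<open>(i, j)\<close> is \<open>t\<close> to the power \<open>\<alpha> i + \<beta> j\<close>. The bounds on \<open>p\<close> allow a choice of exponents such that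
  the \<open>p\<close> core entries have distinct exponents and every other entry repeats one of them
  (\<open>monomial_curve_exists\<close>), so that the determinant is \<open>1\<close> there.
\<close>

section \<open>Small perturbations along a line\<close>

lemma real_polynomial_function_nonzero_near_0:
  fixes f :: "real \<Rightarrow> real"
  assumes "real_polynomial_function f" "f 1 \<noteq> 0" "\<delta> > 0"
  obtains \<tau> where "0 < \<tau>" "\<tau> < \<delta>" "f \<tau> \<noteq> 0"
proof -
  obtain a n where f: "f = (\<lambda>x. \<Sum>i\<le>n. a i * x ^ i)"
    using assms(1) real_polynomial_function_iff_sum by blast
  define q where "q = (\<Sum>i\<le>n. monom (a i) i)"
  have q: "f x = poly q x" for x
    by (simp add: f q_def poly_sum poly_monom)
  have "q \<noteq> 0" using assms(2) by (auto simp: q)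
  then have "finite {x. poly q x = 0}" by (rule poly_roots_finite)
  moreover have "infinite {0<..<\<delta>}" using assms(3) by simp
  ultimately have "\<not> {0<..<\<delta>} \<subseteq> {x. poly q x = 0}" using finite_subset by blast
  then obtain \<tau> where "\<tau> \<in> {0<..<\<delta>}" "poly q \<tau> \<noteq> 0" by blast
  then show thesis using that[of \<tau>] by (simp add: q)
qed

lemma real_polynomial_function_affine: "real_polynomial_function (\<lambda>\<tau>::real. a + \<tau> * b)"
  by (intro real_polynomial_function.intros(3,4))
    (auto intro: real_polynomial_function.intros(1,2) bounded_linear_ident)

text \<open>Determinants along a polynomial path of matrices inherit the polynomial dependence; this is how
  genericity is reduced to finitely many roots.\<close>

lemma real_polynomial_function_det:
  fixes A :: "real \<Rightarrow> real^'k^'k"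
  assumes "\<And>i j. real_polynomial_function (\<lambda>\<tau>. A \<tau> $ i $ j)"
  shows "real_polynomial_function (\<lambda>\<tau>. det (A \<tau>))"
  unfolding det_def
  by (intro real_polynomial_function_sum real_polynomial_function.intros(4)
      real_polynomial_function_prod real_polynomial_function.intros(2) assms finite_permutations) auto

text \<open>This turns an asymptotic estimate into exact information: a polynomial that is small to order \<open>n\<close>
  at \<open>0\<close> must be divisible by the \<open>n\<close>-th power of the variable. Peel off one factor at a time.\<close>

lemma coeff_eq_0_of_bigo_power:
  fixes f :: "real poly"
  assumes "poly f \<in> O[at_right 0](\<lambda>t. t ^ n)" "d < n"
  shows "coeff f d = 0"
  using assms
proof (induction n arbitrary: f d)
  case 0
  from \<open>d < 0\<close> show ?case by simp
next
  case (Suc n f d)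
  obtain a g where f: "f = pCons a g" by (cases f)
  obtain C where C: "\<forall>\<^sub>F t in at_right 0. norm (poly f t) \<le> C * norm (t ^ Suc n)"
    using Suc.prems(1) unfolding bigo_def by blast
  have "((\<lambda>t::real. C * norm (t ^ Suc n)) \<longlongrightarrow> C * norm ((0::real) ^ Suc n)) (at_right 0)"
    by (intro tendsto_intros)
  then have "((\<lambda>t::real. C * norm (t ^ Suc n)) \<longlongrightarrow> 0) (at_right 0)" by simp
  with C have "(poly f \<longlongrightarrow> 0) (at_right 0)"
    by (rule Lim_null_comparison)
  moreover have "(poly f \<longlongrightarrow> poly f 0) (at_right 0)"
    by (intro tendsto_intros)
  ultimately have "poly f 0 = 0"
    by (intro tendsto_unique[OF trivial_limit_at_right_real])
  then have a: "a = 0" by (simp add: f)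
  have "\<forall>\<^sub>F t in at_right 0. norm (poly g t) \<le> C * norm (t ^ n)"
    using C eventually_at_right_less[of 0]
  proof eventually_elim
    case (elim t)
    then have "t * \<bar>poly g t\<bar> \<le> t * (C * norm (t ^ n))"
      by (simp add: f a abs_mult mult_ac)
    then show ?case using elim(2) by simp
  qed
  then have "poly g \<in> O[at_right 0](\<lambda>t. t ^ n)" by (rule bigoI)
  note IH = Suc.IH[OF this]
  show ?case
  proof (cases d)
    case 0
    then show ?thesis by (simp add: f a)
  next
    case (Suc d')
    then show ?thesis using IH[of d'] \<open>d < Suc n\<close> by (simp add: f)
  qed
qed

lemma line_stays_in_open:
  fixes x z :: "'a::real_normed_vector"
  assumes "open U" "x \<in> U"
  obtains \<delta> where "\<delta> > 0" "\<And>\<tau>. 0 < \<tau> \<Longrightarrow> \<tau> < \<delta> \<Longrightarrow> x + \<tau> *\<^sub>R z \<in> U"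
proof -
  have "((\<lambda>\<tau>. x + \<tau> *\<^sub>R z) \<longlongrightarrow> x) (at_right 0)"
    by (auto intro!: tendsto_eq_intros)
  then have "\<forall>\<^sub>F \<tau> in at_right 0. x + \<tau> *\<^sub>R z \<in> U"
    using topological_tendstoD assms by blast
  then obtain \<delta> where "\<delta> > 0" "\<forall>\<tau>>0. \<tau> < \<delta> \<longrightarrow> x + \<tau> *\<^sub>R z \<in> U"
    unfolding eventually_at_right_field by blast
  then show thesis by (intro that) blast+
qed

section \<open>Exponents of a monomial curve of rank one matrices\<close>

text \<open>Rows are numbered \<open>0..a\<close> and columns \<open>0..b\<close>, with the base at \<open>(0, 0)\<close>. Columns up to \<open>c\<close> get the
  exponents \<open>1..c\<close>, and rows the exponents \<open>1, 1 + c, 1 + 2c, \<dots>\<close>, so that sums of the two run through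
  \<open>2..a * c + 1\<close> without repetition. The remaining \<open>b - c\<close> columns get multiples of \<open>M\<close>. Taking
  \<open>M = a * c + 2\<close>, which exceeds all these sums, keeps the sums that involve such a column apart.\<close>

definition row_exponent :: "nat \<Rightarrow> nat \<Rightarrow> nat"
  where "row_exponent c x = (if x = 0 then 0 else 1 + (x - 1) * c)"

definition col_exponent :: "nat \<Rightarrow> nat \<Rightarrow> nat \<Rightarrow> nat"
  where "col_exponent c M y = (if y \<le> c then y else M * (y - c))"

text \<open>Besides the positions off the base row and column, one position is core for each exponent that these miss:
  \<open>(1, 0)\<close> for the exponent \<open>1\<close>, and those of the base row beyond column \<open>c\<close> for the multiples of \<open>M\<close>. Varying \<open>c\<close> from \<open>b\<close> to \<open>1\<close> realises every size from \<open>a * b + 1\<close> to \<open>a * b + b\<close>.\<close>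

definition core_positions :: "nat \<Rightarrow> nat \<Rightarrow> nat \<Rightarrow> (nat \<times> nat) set"
  where "core_positions a b c = {1..a} \<times> {1..b} \<union> {(1, 0)} \<union> {0} \<times> {c<..b}"

lemma card_core_positions:
  assumes "c \<le> b"
  shows "card (core_positions a b c) = a * b + 1 + (b - c)"
proof -
  have "card (core_positions a b c) = card ({1..a} \<times> {1..b}) + card {(1::nat, 0::nat)} + card ({0::nat} \<times> {c<..b})"
    unfolding core_positions_def by (subst card_Un_disjoint; (subst card_Un_disjoint)?) auto
  then show ?thesis by (simp add: card_cartesian_product)
qed

lemma row_exponent_inj:
  assumes "c > 0" "row_exponent c x + y = row_exponent c x' + y'"
    "x > 0" "x' > 0" "1 \<le> y" "y \<le> c" "1 \<le> y'" "y' \<le> c"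
  shows "x = x' \<and> y = y'"
proof -
  have "(x - 1) * c + (y - 1) = (x' - 1) * c + (y' - 1)"
    using assms by (simp add: row_exponent_def)
  then have "((x - 1) * c + (y - 1)) div c = ((x' - 1) * c + (y' - 1)) div c"
    "((x - 1) * c + (y - 1)) mod c = ((x' - 1) * c + (y' - 1)) mod c" by simp_all
  moreover have "y - 1 < c" "y' - 1 < c" using assms by auto
  ultimately have "x - 1 = x' - 1" "y - 1 = y' - 1" by simp_all
  then show ?thesis using assms by linarith
qed

text \<open>Division by \<open>M\<close> recovers the column if it lies beyond \<open>c\<close>, and then the remainder determines the row.
  Otherwise the remainder determines row and column, as a number in base \<open>c\<close> determines its digits.\<close>

lemma inj_on_exponent:
  assumes c: "0 < c" "c \<le> b" and a: "0 < a" and M: "M = a * c + 2"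
  shows "inj_on (\<lambda>(x, y). row_exponent c x + col_exponent c M y) (core_positions a b c)"
proof (rule inj_onI, clarify)
  fix x y x' y'
  assume core: "(x, y) \<in> core_positions a b c" "(x', y') \<in> core_positions a b c"
    and eq: "row_exponent c x + col_exponent c M y = row_exponent c x' + col_exponent c M y'"
  define low where "low x y = row_exponent c x + (if y \<le> c then y else 0)" for x y
  define high where "high y = (if y \<le> c then 0 else y - c)" for y
  have split: "row_exponent c x + col_exponent c M y = M * high y + low x y" for x y
    by (simp add: low_def high_def col_exponent_def)
  have low: "low x y < M" if "(x, y) \<in> core_positions a b c" for x y
  proof (cases "x = 0")
    case True
    then show ?thesis using that a c by (auto simp: core_positions_def low_def row_exponent_def M)
  next
    case False
    then have "x \<le> a" using that a by (auto simp: core_positions_def)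
    then have "(x - 1) * c + c \<le> a * c"
      using False mult_le_mono1[of x a c] by (cases x) auto
    then show ?thesis using False by (simp add: low_def row_exponent_def M)
  qed
  have "(M * high y + low x y) div M = (M * high y' + low x' y') div M"
    "(M * high y + low x y) mod M = (M * high y' + low x' y') mod M"
    using eq unfolding split by simp_all
  then have "high y = high y'" "low x y = low x' y'"
    using low[OF core(1)] low[OF core(2)] by simp_all
  show "x = x' \<and> y = y'"
  proof (cases "y \<le> c")
    case True
    then have y': "y' \<le> c" using \<open>high y = high y'\<close> by (auto simp: high_def split: if_splits)
    have row: "row_exponent c x + y = row_exponent c x' + y'"
      using \<open>low x y = low x' y'\<close> True y' by (simp add: low_def)
    have pos: "x > 0" "x' > 0" and one: "y = 0 \<longrightarrow> x = 1" "y' = 0 \<longrightarrow> x' = 1"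
      using core True y' by (auto simp: core_positions_def)
    have row_one: "row_exponent c 1 = 1" and row_pos: "row_exponent c x > 0" "row_exponent c x' > 0"
      using pos by (simp_all add: row_exponent_def)
    show ?thesis
    proof (cases "y = 0 \<longleftrightarrow> y' = 0")
      case True
      then show ?thesis
        using one row_exponent_inj[OF c(1) row pos] \<open>y \<le> c\<close> y' by (cases "y = 0") simp_all
    next
      case False
      then have "row_exponent c x = 1 \<and> y = 0 \<and> y' > 0 \<or> row_exponent c x' = 1 \<and> y' = 0 \<and> y > 0"
        using one row_one by auto
      then show ?thesis using row row_pos by linarith
    qed
  next
    case False
    then have y': "\<not> y' \<le> c" "y = y'" using \<open>high y = high y'\<close> by (auto simp: high_def split: if_splits)
    then have "row_exponent c x = row_exponent c x'"
      using \<open>low x y = low x' y'\<close> by (simp add: low_def)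
    then show ?thesis using y' c by (auto simp: row_exponent_def split: if_splits)
  qed
qed

text \<open>In the base column, row \<open>x \<ge> 2\<close> has the exponent of position \<open>(x - 1, c)\<close>; in the base row, column
  \<open>y\<close> with \<open>2 \<le> y \<le> c\<close> has that of \<open>(1, y - 1)\<close>, and column \<open>1\<close> that of \<open>(1, 0)\<close>.\<close>

lemma exponent_covered:
  assumes "0 < c" "c \<le> b" "0 < a" "x \<le> a" "y \<le> b" "(x, y) \<noteq> (0, 0)"
  shows "\<exists>(x', y') \<in> core_positions a b c.
           row_exponent c x' + col_exponent c M y' = row_exponent c x + col_exponent c M y"
proof -
  consider "(x, y) \<in> core_positions a b c" | "y = 0" "2 \<le> x" | "x = 0" "y = 1" | "x = 0" "2 \<le> y" "y \<le> c"
    using assms by (auto simp: core_positions_def) linarith+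
  then show ?thesis
  proof cases
    case 1
    then show ?thesis by blast
  next
    case 2
    then have "row_exponent c (x - 1) + c = row_exponent c x"
      by (cases x; cases "x - 1") (auto simp: row_exponent_def)
    then show ?thesis
      using 2 assms by (intro bexI[of _ "(x - 1, c)"]) (auto simp: col_exponent_def core_positions_def)
  next
    case 3
    then show ?thesis using assms
      by (intro bexI[of _ "(1, 0)"]) (auto simp: col_exponent_def row_exponent_def core_positions_def)
  next
    case 4
    then show ?thesis using assms
      by (intro bexI[of _ "(1, y - 1)"]) (auto simp: col_exponent_def row_exponent_def core_positions_def)
  qed
qed

text \<open>What the rest of the argument needs from the exponents: \<open>\<sigma>\<close> enumerates the core positions, and
  the matrix with entries \<open>t ^ (\<alpha> i + \<beta> j)\<close> has rank one for every \<open>t\<close>.\<close>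

locale monomial_curve =
  fixes \<sigma> :: "'p::finite \<Rightarrow> 'n::finite \<times> 'm::finite"
    and \<alpha> :: "'n \<Rightarrow> nat" and \<beta> :: "'m \<Rightarrow> nat" and i0 :: 'n and j0 :: 'm
  assumes alpha_eq_0_iff: "\<alpha> i = 0 \<longleftrightarrow> i = i0"
    and beta_eq_0_iff: "\<beta> j = 0 \<longleftrightarrow> j = j0"
    and inner_position: "i \<noteq> i0 \<Longrightarrow> j \<noteq> j0 \<Longrightarrow> (i, j) \<in> range \<sigma>"
    and base_position: "(i0, j0) \<notin> range \<sigma>"
    and inj_exponent: "inj (\<lambda>q. \<alpha> (fst (\<sigma> q)) + \<beta> (snd (\<sigma> q)))"
    and exponent_attained: "(i, j) \<noteq> (i0, j0) \<Longrightarrow> \<exists>q. \<alpha> (fst (\<sigma> q)) + \<beta> (snd (\<sigma> q)) = \<alpha> i + \<beta> j"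

text \<open>The number of columns that get multiples of \<open>M\<close> is \<open>e\<close>, the excess of \<open>p\<close> over \<open>(m - 1) (n - 1) + 1\<close>. The
  upper bound on \<open>p\<close> says that \<open>e\<close> is less than the number \<open>m - 1\<close> of columns other than the base, so at
  least one column keeps a small exponent.\<close>

lemma monomial_curve_exists:
  assumes "(CARD('m::finite) - 1) * (CARD('n::finite) - 1) + 1 \<le> CARD('p::finite)"
    and "CARD('p) \<le> (CARD('m) - 1) * CARD('n)" and "CARD('n) \<ge> 2"
  shows "\<exists>(\<sigma> :: 'p \<Rightarrow> 'n \<times> 'm) \<alpha> \<beta> i0 j0. monomial_curve \<sigma> \<alpha> \<beta> i0 j0"
proof -
  define a b where "a = CARD('n) - 1" and "b = CARD('m) - 1"
  define e where "e = CARD('p) - (a * b + 1)"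
  define c where "c = b - e"
  define M where "M = a * c + 2"
  have n: "CARD('n) = Suc a" using assms(3) by (simp add: a_def)
  have m: "CARD('m) = Suc b" by (simp add: b_def)
  have p: "CARD('p) = a * b + 1 + e" using assms(1) by (simp add: e_def a_def b_def mult.commute)
  have "a * b + 1 + e \<le> b * Suc a" using assms(2) unfolding p n b_def[symmetric] by simp
  then have "e < b" by (simp add: algebra_simps)
  then have c: "0 < c" "c \<le> b" "b - c = e" by (auto simp: c_def)
  have a: "0 < a" using assms(3) by (simp add: a_def)
  obtain f :: "'n \<Rightarrow> nat" where f: "bij_betw f UNIV {0..<Suc a}"
    using ex_bij_betw_finite_nat[of "UNIV :: 'n set"] n by auto
  obtain g :: "'m \<Rightarrow> nat" where g: "bij_betw g UNIV {0..<Suc b}"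
    using ex_bij_betw_finite_nat[of "UNIV :: 'm set"] m by auto
  define fi where "fi = inv_into UNIV f"
  define gi where "gi = inv_into UNIV g"
  have fi: "f (fi x) = x" if "x \<le> a" for x
    unfolding fi_def using f that by (intro f_inv_into_f) (auto simp: bij_betw_def)
  have gi: "g (gi y) = y" if "y \<le> b" for y
    unfolding gi_def using g that by (intro f_inv_into_f) (auto simp: bij_betw_def)
  have f_inj: "f i = f i' \<longleftrightarrow> i = i'" for i i' using f by (auto simp: bij_betw_def inj_on_def)
  have g_inj: "g j = g j' \<longleftrightarrow> j = j'" for j j' using g by (auto simp: bij_betw_def inj_on_def)
  have f_le: "f i \<le> a" for i using bij_betwE[OF f] by (auto simp: less_Suc_eq_le)
  have g_le: "g j \<le> b" for j using bij_betwE[OF g] by (auto simp: less_Suc_eq_le)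
  have "finite (core_positions a b c)" by (simp add: core_positions_def)
  moreover have "card (core_positions a b c) = CARD('p)"
    using card_core_positions[OF c(2)] c(3) p by simp
  ultimately obtain h :: "'p \<Rightarrow> nat \<times> nat" where h: "bij_betw h UNIV (core_positions a b c)"
    by (metis finite_same_card_bij finite)
  have h_core: "h q \<in> core_positions a b c" for q using bij_betwE[OF h] by auto
  define \<sigma> :: "'p \<Rightarrow> 'n \<times> 'm" where "\<sigma> q = (fi (fst (h q)), gi (snd (h q)))" for q
  define \<alpha> where "\<alpha> i = row_exponent c (f i)" for i
  define \<beta> where "\<beta> j = col_exponent c M (g j)" for j
  have core_le: "x \<le> a" "y \<le> b" if "(x, y) \<in> core_positions a b c" for x y
    using that a by (auto simp: core_positions_def)
  have f_sigma: "f (fst (\<sigma> q)) = fst (h q)" "g (snd (\<sigma> q)) = snd (h q)" for q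
    using core_le[of "fst (h q)" "snd (h q)"] h_core[of q] by (simp_all add: \<sigma>_def fi gi)
  have exponent: "\<alpha> (fst (\<sigma> q)) + \<beta> (snd (\<sigma> q)) = row_exponent c (fst (h q)) + col_exponent c M (snd (h q))" for q
    by (simp add: \<alpha>_def \<beta>_def f_sigma)
  have sigmaI: "(i, j) \<in> range \<sigma>" if ij: "(f i, g j) \<in> core_positions a b c" for i j
  proof -
    obtain q where "h q = (f i, g j)" using h ij by (metis bij_betw_imp_surj_on imageE)
    then have "\<sigma> q = (i, j)"
      using f_sigma[of q] by (intro prod_eqI) (auto simp: f_inj g_inj)
    then show ?thesis by (metis rangeI)
  qed
  have "monomial_curve \<sigma> \<alpha> \<beta> (fi 0) (gi 0)"
  proof
    show "\<alpha> i = 0 \<longleftrightarrow> i = fi 0" for i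
      using fi[of 0] by (auto simp: \<alpha>_def row_exponent_def f_inj[symmetric])
    show "\<beta> j = 0 \<longleftrightarrow> j = gi 0" for j
      using gi[of 0] c by (auto simp: \<beta>_def col_exponent_def M_def g_inj[symmetric])
    show "(i, j) \<in> range \<sigma>" if "i \<noteq> fi 0" "j \<noteq> gi 0" for i j
    proof (rule sigmaI)
      have "f i \<noteq> 0" "g j \<noteq> 0" using that fi[of 0] gi[of 0] f_inj g_inj by (metis zero_le)+
      then show "(f i, g j) \<in> core_positions a b c"
        using f_le[of i] g_le[of j] by (auto simp: core_positions_def)
    qed
    show "(fi 0, gi 0) \<notin> range \<sigma>"
    proof
      assume "(fi 0, gi 0) \<in> range \<sigma>"
      then obtain q where "\<sigma> q = (fi 0, gi 0)" by (metis imageE)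
      then have "h q = (0, 0)" using f_sigma[of q] fi[of 0] gi[of 0] by (simp add: prod_eq_iff)
      then show False using h_core[of q] by (auto simp: core_positions_def)
    qed
    show "inj (\<lambda>q. \<alpha> (fst (\<sigma> q)) + \<beta> (snd (\<sigma> q)))"
    proof (rule injI)
      fix q q' assume "\<alpha> (fst (\<sigma> q)) + \<beta> (snd (\<sigma> q)) = \<alpha> (fst (\<sigma> q')) + \<beta> (snd (\<sigma> q'))"
      then have "h q = h q'"
        using inj_onD[OF inj_on_exponent[OF c(1,2) a M_def] _ h_core[of q] h_core[of q']]
        unfolding exponent by (simp add: case_prod_beta)
      then show "q = q'" using h by (metis bij_betw_imp_inj_on injD)
    qed
    show "\<exists>q. \<alpha> (fst (\<sigma> q)) + \<beta> (snd (\<sigma> q)) = \<alpha> i + \<beta> j" if "(i, j) \<noteq> (fi 0, gi 0)" for i j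
    proof -
      have "(f i, g j) \<noteq> (0, 0)" using that fi[of 0] gi[of 0] f_inj g_inj by (metis Pair_inject zero_le)
      then obtain x y where xy: "(x, y) \<in> core_positions a b c"
        and "row_exponent c x + col_exponent c M y = \<alpha> i + \<beta> j"
        using exponent_covered[OF c(1,2) a f_le g_le, of i j M] unfolding \<alpha>_def \<beta>_def by blast
      moreover obtain q where "h q = (x, y)" using h xy by (metis bij_betw_imp_surj_on imageE)
      ultimately show ?thesis using exponent[of q] by auto
    qed
  qed
  then show ?thesis by blast
qed

section \<open>Curves of rank one matrices in a given linear system\<close>

context monomial_curve
begin

definition core_exponent :: "'p \<Rightarrow> nat"
  where "core_exponent q = \<alpha> (fst (\<sigma> q)) + \<beta> (snd (\<sigma> q))"

text \<open>Such coefficients express all entries of a matrix with zero base entry through its core entries; they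
  parametrise the generic \<open>p\<close>-dimensional spaces of such matrices.\<close>

definition graph_coeffs :: "('n \<Rightarrow> 'm \<Rightarrow> 'p \<Rightarrow> real) \<Rightarrow> bool"
  where "graph_coeffs B \<longleftrightarrow>
    (\<forall>q q'. B (fst (\<sigma> q)) (snd (\<sigma> q)) q' = of_bool (q = q')) \<and> (\<forall>q. B i0 j0 q = 0)"

definition entry :: "('n \<Rightarrow> 'm \<Rightarrow> 'p \<Rightarrow> real) \<Rightarrow> 'n \<Rightarrow> 'm \<Rightarrow> real^'p \<Rightarrow> real"
  where "entry B i j w = (\<Sum>q\<in>UNIV. B i j q * w $ q)"

definition product_core :: "'p \<Rightarrow> bool"
  where "product_core q \<longleftrightarrow> fst (\<sigma> q) \<noteq> i0 \<and> snd (\<sigma> q) \<noteq> j0"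

text \<open>Fixed points \<open>w\<close> are the rank one matrices in the linear system of \<open>B\<close>, normalised to have base entry
  \<open>1\<close>, whose core entries in the base row and column are the prescribed powers of \<open>t\<close>.\<close>

definition step :: "('n \<Rightarrow> 'm \<Rightarrow> 'p \<Rightarrow> real) \<Rightarrow> real \<Rightarrow> real^'p \<Rightarrow> real^'p"
  where "step B t w = (\<chi> q. if product_core q
    then entry B (fst (\<sigma> q)) j0 w * entry B i0 (snd (\<sigma> q)) w else t ^ core_exponent q)"

text \<open>The iterates of \<open>step\<close> from \<open>0\<close>, with \<open>t\<close> as the variable of a polynomial. They are not truncated:
  only their coefficients up to degree \<open>k\<close> are meaningful.\<close>

primrec jet :: "('n \<Rightarrow> 'm \<Rightarrow> 'p \<Rightarrow> real) \<Rightarrow> nat \<Rightarrow> 'p \<Rightarrow> real poly"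
  where
    "jet B 0 = (\<lambda>q. 0)"
  | "jet B (Suc k) = (\<lambda>q. if product_core q
      then (\<Sum>q'\<in>UNIV. smult (B (fst (\<sigma> q)) j0 q') (jet B k q')) *
           (\<Sum>q'\<in>UNIV. smult (B i0 (snd (\<sigma> q)) q') (jet B k q'))
      else monom 1 (core_exponent q))"

text \<open>The bound \<open>O(t)\<close> selects solutions near the base matrix. With the equation it forces the Taylor
  expansion to every order, so that a separate choice of fixed point for each \<open>t\<close> gives a curve.\<close>

definition solution_curve :: "('n \<Rightarrow> 'm \<Rightarrow> 'p \<Rightarrow> real) \<Rightarrow> (real \<Rightarrow> real^'p) \<Rightarrow> bool"
  where "solution_curve B w \<longleftrightarrow> (\<forall>\<^sub>F t in at_right 0. step B t (w t) = w t) \<and>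
    (\<forall>q. (\<lambda>t. w t $ q) \<in> O[at_right 0](\<lambda>t. t))"

definition rank_one_row :: "('n \<Rightarrow> 'm \<Rightarrow> 'p \<Rightarrow> real) \<Rightarrow> real^'p \<Rightarrow> real^'n"
  where "rank_one_row B w = (\<chi> i. if i = i0 then 1 else entry B i j0 w)"

definition rank_one_col :: "('n \<Rightarrow> 'm \<Rightarrow> 'p \<Rightarrow> real) \<Rightarrow> real^'p \<Rightarrow> real^'m"
  where "rank_one_col B w = (\<chi> j. if j = j0 then 1 else entry B i0 j w)"

text \<open>On the monomial curve, every entry but the base one is a copy of the core entry with the same exponent.\<close>

definition monomial_coeffs :: "'n \<Rightarrow> 'm \<Rightarrow> 'p \<Rightarrow> real"
  where "monomial_coeffs i j q = of_bool ((i, j) \<noteq> (i0, j0) \<and> core_exponent q = \<alpha> i + \<beta> j)"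

text \<open>Large enough for all exponents of core entries to be seen by the jet.\<close>

definition jet_order :: nat
  where "jet_order = Max (range core_exponent)"

definition jet_matrix :: "('n \<Rightarrow> 'm \<Rightarrow> 'p \<Rightarrow> real) \<Rightarrow> real^'p^'p"
  where "jet_matrix B = (\<chi> d q. coeff (jet B jet_order q) (core_exponent d))"

lemma core_exponent_eq_iff: "core_exponent q = core_exponent q' \<longleftrightarrow> q = q'"
  using inj_exponent by (auto simp: core_exponent_def inj_def)

lemma core_exponent_pos: "core_exponent q > 0"
proof (rule ccontr)
  assume "\<not> core_exponent q > 0"
  then have "\<sigma> q = (i0, j0)"
    by (simp add: core_exponent_def alpha_eq_0_iff beta_eq_0_iff prod_eq_iff)
  then show False using base_position by (metis rangeI)
qed

lemma entry_core:
  assumes "graph_coeffs B"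
  shows "entry B (fst (\<sigma> q)) (snd (\<sigma> q)) w = w $ q"
proof -
  have "B (fst (\<sigma> q)) (snd (\<sigma> q)) = (\<lambda>q'. of_bool (q = q'))"
    using assms unfolding graph_coeffs_def by blast
  then show ?thesis by (simp add: entry_def)
qed

lemma entry_base: "graph_coeffs B \<Longrightarrow> entry B i0 j0 w = 0"
  by (simp add: graph_coeffs_def entry_def)

lemma linear_entry: "linear (entry B i j)"
  unfolding entry_def
  by (rule linearI) (simp_all add: algebra_simps sum.distrib sum_distrib_left)

text \<open>Off the base row and column this is the fixed point equation, because all those positions are core. In
  the base row or column one of the two factors is \<open>1\<close>.\<close>

lemma rank_one_entry:
  assumes B: "graph_coeffs B" and w: "step B t w = w"
  shows "rank_one_row B w $ i * rank_one_col B w $ j = of_bool (i = i0 \<and> j = j0) + entry B i j w"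
proof (cases "i = i0 \<or> j = j0")
  case True
  then show ?thesis using entry_base[OF B] by (auto simp: rank_one_row_def rank_one_col_def)
next
  case False
  then obtain q where q: "\<sigma> q = (i, j)" using inner_position[of i j] by (metis imageE)
  then have "w $ q = entry B i j0 w * entry B i0 j w"
    using False by (subst w[symmetric]) (simp add: step_def product_core_def)
  moreover have "entry B i j w = w $ q" using entry_core[OF B, of q] q by simp
  ultimately show ?thesis using False by (simp add: rank_one_row_def rank_one_col_def)
qed

lemma entry_bounded:
  obtains L where "\<And>i j w. \<bar>entry B i j w\<bar> \<le> L * norm w"
proof
  fix i j w
  have "\<bar>entry B i j w\<bar> \<le> (\<Sum>q\<in>UNIV. \<bar>B i j q\<bar> * norm w)"
    unfolding entry_def
    by (rule order.trans[OF sum_abs sum_mono])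
      (simp add: abs_mult mult_left_mono component_le_norm_cart)
  also have "\<dots> = (\<Sum>q\<in>UNIV. \<bar>B i j q\<bar>) * norm w" by (simp add: sum_distrib_right)
  also have "(\<Sum>q\<in>UNIV. \<bar>B i j q\<bar>) \<le> (\<Sum>j\<in>UNIV. \<Sum>q\<in>UNIV. \<bar>B i j q\<bar>)"
    by (rule member_le_sum) (auto intro: sum_nonneg)
  also have "\<dots> \<le> (\<Sum>i\<in>UNIV. \<Sum>j\<in>UNIV. \<Sum>q\<in>UNIV. \<bar>B i j q\<bar>)"
    by (rule member_le_sum) (auto intro!: sum_nonneg)
  finally show "\<bar>entry B i j w\<bar> \<le> (\<Sum>i\<in>UNIV. \<Sum>j\<in>UNIV. \<Sum>q\<in>UNIV. \<bar>B i j q\<bar>) * norm w"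
    by (simp add: mult_right_mono)
qed

lemma continuous_on_step: "continuous_on S (step B t)"
proof -
  have "continuous_on S (\<lambda>w. step B t w $ q)" for q
    by (cases "product_core q") (auto simp: step_def entry_def intro!: continuous_intros)
  then have "continuous_on S (\<lambda>w. \<chi> q. step B t w $ q)" by (rule continuous_on_vec_lambda)
  then show ?thesis by simp
qed

text \<open>The prescribed powers are at most \<open>t\<close>, and the products are of order \<open>t\<^sup>2\<close> on a ball of radius
  \<open>O(t)\<close>. So for small \<open>t\<close> the map \<open>step B t\<close> preserves the ball of radius \<open>p t\<close>, and Brouwer's
  theorem gives a fixed point there.\<close>

lemma solution_curve_exists: "\<exists>w. solution_curve B w"
proof -
  obtain L where L: "\<And>i j w. \<bar>entry B i j w\<bar> \<le> L * norm w"
    using entry_bounded by blast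
  define p where "p = real CARD('p)"
  have p: "p > 0" by (simp add: p_def)
  \<comment> \<open>chosen so that products of two entries are at most \<open>(L p t)\<^sup>2 \<le> t\<close> for \<open>t < \<delta>\<close>\<close>
  define \<delta> where "\<delta> = 1 / (1 + (L * p)\<^sup>2)"
  have delta: "\<delta> > 0" "\<delta> \<le> 1" by (auto simp: \<delta>_def divide_simps add_pos_nonneg)
  have ex: "\<exists>w. step B t w = w \<and> norm w \<le> p * t" if t: "0 < t" "t < \<delta>" for t
  proof -
    have "t * (1 + (L * p)\<^sup>2) \<le> 1"
      using t by (simp add: \<delta>_def pos_less_divide_eq add_pos_nonneg)
    moreover have "t * (1 + (L * p)\<^sup>2) = t + (L * p)\<^sup>2 * t" by (simp add: algebra_simps)
    ultimately have small: "(L * p)\<^sup>2 * t \<le> 1" using t(1) by linarith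
    have "norm (step B t w) \<le> p * t" if w: "norm w \<le> p * t" for w
    proof -
      have "\<bar>step B t w $ q\<bar> \<le> t" for q
      proof (cases "product_core q")
        case True
        have L0: "0 \<le> L * norm w" using L[of i0 j0 w] by linarith
        have "\<bar>step B t w $ q\<bar> = \<bar>entry B (fst (\<sigma> q)) j0 w\<bar> * \<bar>entry B i0 (snd (\<sigma> q)) w\<bar>"
          using True by (simp add: step_def abs_mult)
        also have "\<dots> \<le> (L * norm w) * (L * norm w)"
          using L L0 by (intro mult_mono) auto
        also have "\<dots> = L\<^sup>2 * (norm w)\<^sup>2" by (simp add: power2_eq_square)
        also have "\<dots> \<le> L\<^sup>2 * (p * t)\<^sup>2"
          using w by (intro mult_left_mono power_mono) auto
        also have "\<dots> = ((L * p)\<^sup>2 * t) * t" by (simp add: power2_eq_square)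
        also have "\<dots> \<le> 1 * t" using small t by (intro mult_right_mono) auto
        finally show ?thesis by simp
      next
        case False
        have "t ^ core_exponent q \<le> t ^ 1"
          using t delta core_exponent_pos[of q] by (intro power_decreasing) auto
        then show ?thesis using False t by (simp add: step_def)
      qed
      then have "(\<Sum>q\<in>UNIV. \<bar>step B t w $ q\<bar>) \<le> p * t"
        using sum_bounded_above[of UNIV "\<lambda>q. \<bar>step B t w $ q\<bar>" t] by (simp add: p_def)
      then show ?thesis using norm_le_l1_cart order_trans by blast
    qed
    then have "step B t \<in> cball 0 (p * t) \<rightarrow> cball 0 (p * t)" by auto
    moreover have "p * t > 0" using p t by simp
    ultimately obtain w where "w \<in> cball 0 (p * t)" "step B t w = w"
      using brouwer_ball[OF _ continuous_on_step] by blast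
    then show ?thesis by auto
  qed
  define w where "w t = (SOME w. step B t w = w \<and> norm w \<le> p * t)" for t
  have w: "step B t (w t) = w t \<and> norm (w t) \<le> p * t" if "0 < t" "t < \<delta>" for t
    unfolding w_def using someI_ex[OF ex[OF that]] .
  have small: "\<forall>\<^sub>F t in at_right 0. 0 < t \<and> t < \<delta>"
    unfolding eventually_at_right_field using delta by auto
  have "(\<lambda>t. w t $ q) \<in> O[at_right 0](\<lambda>t. t)" for q
  proof (rule bigoI)
    show "\<forall>\<^sub>F t in at_right 0. norm (w t $ q) \<le> p * norm t"
      using small
    proof eventually_elim
      case (elim t)
      then show ?case using w[of t] component_le_norm_cart[of "w t" q] by simp
    qed
  qed
  moreover have "\<forall>\<^sub>F t in at_right 0. step B t (w t) = w t"
    using small by eventually_elim (use w in blast)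
  ultimately show ?thesis unfolding solution_curve_def by blast
qed

lemma entry_bigo:
  assumes "\<And>q. (\<lambda>t. w t $ q) \<in> O[F](g)"
  shows "(\<lambda>t. entry B i j (w t)) \<in> O[F](g)"
  unfolding entry_def by (intro big_sum_in_bigo) (use assms in simp)

text \<open>Each application of \<open>step\<close> gains an order: the difference of two products of \<open>O(t)\<close> quantities is the
  difference of the factors times another \<open>O(t)\<close>.\<close>

lemma solution_curve_jet:
  assumes w: "solution_curve B w"
  shows "(\<lambda>t. w t $ q - poly (jet B k q) t) \<in> O[at_right 0](\<lambda>t. t ^ Suc k)"
proof (induction k arbitrary: q)
  case 0
  then show ?case using w by (simp add: solution_curve_def)
next
  case (Suc k)
  have fixed: "\<forall>\<^sub>F t in at_right 0. step B t (w t) = w t"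
    and w_O: "(\<lambda>t. w t $ q) \<in> O[at_right 0](\<lambda>t. t)" for q
    using w by (auto simp: solution_curve_def)
  define P where "P t = (\<chi> q. poly (jet B k q) t)" for t
  have PO: "(\<lambda>t. (w t - P t) $ q) \<in> O[at_right 0](\<lambda>t. t ^ Suc k)" for q
    using Suc by (simp add: P_def)
  have "(\<lambda>t::real. t ^ Suc k) \<in> O[at_right 0](\<lambda>t. t)"
  proof (rule bigoI[of _ 1])
    show "\<forall>\<^sub>F t::real in at_right 0. norm (t ^ Suc k) \<le> 1 * norm t"
      unfolding eventually_at_right_field
      by (intro exI[of _ 1]) (auto intro!: mult_left_le power_le_one)
  qed
  then have "(\<lambda>t. (w t - P t) $ q) \<in> O[at_right 0](\<lambda>t. t)" for q
    using PO landau_o.big_trans by blast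
  then have P_O: "(\<lambda>t. P t $ q) \<in> O[at_right 0](\<lambda>t. t)" for q
    using sum_in_bigo(2)[OF w_O[of q], of "\<lambda>t. (w t - P t) $ q"] by simp
  show ?case
  proof (cases "product_core q")
    case False
    have "\<forall>\<^sub>F t in at_right 0. w t $ q - poly (jet B (Suc k) q) t = 0"
      using fixed
    proof eventually_elim
      case (elim t)
      have "w t $ q = step B t (w t) $ q" by (simp only: elim)
      then show ?case using False by (simp add: step_def poly_monom)
    qed
    from landau_o.big.in_cong[OF this] show ?thesis by simp
  next
    case True
    define i j where "i = fst (\<sigma> q)" and "j = snd (\<sigma> q)"
    have "\<forall>\<^sub>F t in at_right 0. w t $ q - poly (jet B (Suc k) q) t =
        entry B i j0 (w t - P t) * entry B i0 j (w t) + entry B i j0 (P t) * entry B i0 j (w t - P t)"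
      using fixed
    proof eventually_elim
      case (elim t)
      have "w t $ q = entry B i j0 (w t) * entry B i0 j (w t)"
        using True by (subst elim[symmetric]) (simp add: step_def i_def j_def)
      moreover have "poly (jet B (Suc k) q) t = entry B i j0 (P t) * entry B i0 j (P t)"
        using True by (simp add: poly_sum entry_def P_def i_def j_def)
      ultimately show ?case by (simp add: linear_diff[OF linear_entry] algebra_simps)
    qed
    moreover have "(\<lambda>t. entry B i j0 (w t - P t) * entry B i0 j (w t) +
        entry B i j0 (P t) * entry B i0 j (w t - P t)) \<in> O[at_right 0](\<lambda>t. t ^ Suc (Suc k))"
    proof (rule sum_in_bigo)
      show "(\<lambda>t. entry B i j0 (w t - P t) * entry B i0 j (w t)) \<in> O[at_right 0](\<lambda>t. t ^ Suc (Suc k))"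
        using landau_o.big.mult[OF entry_bigo[OF PO] entry_bigo[OF w_O]] by (simp add: mult_ac)
      show "(\<lambda>t. entry B i j0 (P t) * entry B i0 j (w t - P t)) \<in> O[at_right 0](\<lambda>t. t ^ Suc (Suc k))"
        using landau_o.big.mult[OF entry_bigo[OF P_O] entry_bigo[OF PO]] by (simp add: mult_ac)
    qed
    ultimately show ?thesis by (rule landau_o.big.in_cong[THEN iffD2])
  qed
qed

lemma core_exponent_le: "core_exponent q \<le> jet_order"
  by (simp add: jet_order_def)

text \<open>A vector \<open>v\<close> orthogonal to the curve gives a combination of the jets that vanishes to an order
  beyond \<open>jet_order\<close>. Its coefficients at the core exponents are then zero, which says that \<open>v\<close> is in the
  kernel of \<open>jet_matrix B\<close>.\<close>

lemma span_solution_curve: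
  assumes w: "solution_curve B w" and det: "det (jet_matrix B) \<noteq> 0"
  shows "span {w t | t. step B t (w t) = w t} = UNIV"
proof (rule ccontr)
  assume "\<not> ?thesis"
  then obtain v where v: "v \<noteq> 0" "\<And>x. x \<in> span {w t | t. step B t (w t) = w t} \<Longrightarrow> v \<bullet> x = 0"
    using span_not_UNIV_orthogonal by blast
  define f where "f = (\<Sum>q\<in>UNIV. smult (v $ q) (jet B jet_order q))"
  have "\<forall>\<^sub>F t in at_right 0. step B t (w t) = w t"
    using w by (simp add: solution_curve_def)
  then have "\<forall>\<^sub>F t in at_right 0. - (\<Sum>q\<in>UNIV. v $ q * (w t $ q - poly (jet B jet_order q) t)) = poly f t"
  proof eventually_elim
    case (elim t)
    then have "v \<bullet> w t = 0" by (intro v(2) span_base) auto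
    then show ?case
      by (simp add: f_def poly_sum inner_vec_def right_diff_distrib sum_subtractf)
  qed
  moreover have "(\<lambda>t. - (\<Sum>q\<in>UNIV. v $ q * (w t $ q - poly (jet B jet_order q) t)))
      \<in> O[at_right 0](\<lambda>t. t ^ Suc jet_order)"
    using solution_curve_jet[OF w, of _ jet_order]
    by (subst landau_o.big.uminus_in_iff, intro big_sum_in_bigo) simp
  ultimately have "poly f \<in> O[at_right 0](\<lambda>t. t ^ Suc jet_order)"
    by (rule landau_o.big.in_cong[THEN iffD1])
  then have "coeff f (core_exponent d) = 0" for d
    using coeff_eq_0_of_bigo_power core_exponent_le by (blast intro: le_imp_less_Suc)
  then have kernel: "jet_matrix B *v v = 0"
    by (simp add: vec_eq_iff matrix_vector_mult_def jet_matrix_def f_def coeff_sum mult.commute)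
  obtain N where "N ** jet_matrix B = mat 1"
    using det invertible_det_nz[of "jet_matrix B"] unfolding invertible_def by blast
  then have "N *v (jet_matrix B *v v) = v" by (simp add: matrix_vector_mul_assoc)
  then show False using v(1) by (simp add: kernel)
qed

lemma entry_monomial:
  assumes "(i, j) \<noteq> (i0, j0)"
  shows "entry monomial_coeffs i j (\<chi> q. t ^ core_exponent q) = t ^ (\<alpha> i + \<beta> j)"
proof -
  obtain d where d: "core_exponent d = \<alpha> i + \<beta> j"
    using exponent_attained[OF assms] by (auto simp: core_exponent_def)
  have "monomial_coeffs i j = (\<lambda>q. of_bool (q = d))"
    unfolding monomial_coeffs_def using assms by (simp flip: d add: core_exponent_eq_iff)
  then show ?thesis by (simp add: entry_def d)
qed

lemma graph_coeffs_monomial: "graph_coeffs monomial_coeffs"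
proof -
  have "\<sigma> q \<noteq> (i0, j0)" for q using base_position by (metis rangeI)
  then show ?thesis
    by (auto simp: graph_coeffs_def monomial_coeffs_def core_exponent_def[symmetric] core_exponent_eq_iff)
qed

text \<open>At a core position off the base row and column the fixed point equation reads
  \<open>t ^ (\<alpha> i + \<beta> j) = t ^ \<alpha> i * t ^ \<beta> j\<close>.\<close>

lemma solution_curve_monomial: "solution_curve monomial_coeffs (\<lambda>t. \<chi> q. t ^ core_exponent q)"
proof -
  have "step monomial_coeffs t (\<chi> q. t ^ core_exponent q) = (\<chi> q. t ^ core_exponent q)" for t
  proof -
    have "\<alpha> i0 = 0" "\<beta> j0 = 0" by (simp_all add: alpha_eq_0_iff beta_eq_0_iff)
    then show ?thesis
      by (auto simp: step_def vec_eq_iff product_core_def entry_monomial)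
        (simp add: core_exponent_def power_add)
  qed
  moreover have "(\<lambda>t::real. t ^ core_exponent q) \<in> O[at_right 0](\<lambda>t. t)" for q
  proof (rule bigoI[of _ 1])
    obtain k where k: "core_exponent q = Suc k" using core_exponent_pos[of q] gr0_implies_Suc by blast
    show "\<forall>\<^sub>F t::real in at_right 0. norm (t ^ core_exponent q) \<le> 1 * norm t"
      unfolding eventually_at_right_field k
      by (intro exI[of _ 1]) (auto intro!: mult_left_le power_le_one)
  qed
  ultimately show ?thesis by (simp add: solution_curve_def)
qed

text \<open>The jets approximate every solution curve, so their low coefficients are those of the monomial curve;
  distinctness of the core exponents makes the matrix the identity.\<close>

lemma jet_matrix_monomial: "jet_matrix monomial_coeffs = mat 1"
proof -
  have "coeff (jet monomial_coeffs jet_order q) (core_exponent d) = of_bool (d = q)" for d q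
  proof -
    define f where "f = monom 1 (core_exponent q) - jet monomial_coeffs jet_order q"
    have "poly f = (\<lambda>t. (\<chi> q. t ^ core_exponent q) $ q - poly (jet monomial_coeffs jet_order q) t)"
      by (simp add: f_def poly_monom fun_eq_iff)
    then have "poly f \<in> O[at_right 0](\<lambda>t. t ^ Suc jet_order)"
      using solution_curve_jet[OF solution_curve_monomial, of q jet_order] by (simp only:)
    then have "coeff f (core_exponent d) = 0"
      using coeff_eq_0_of_bigo_power core_exponent_le by (blast intro: le_imp_less_Suc)
    then show ?thesis by (auto simp: f_def core_exponent_eq_iff)
  qed
  then show ?thesis by (simp add: jet_matrix_def mat_def vec_eq_iff)
qed

lemma real_polynomial_function_coeff_jet:
  assumes B: "\<And>i j q. real_polynomial_function (\<lambda>\<tau>. B \<tau> i j q)"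
  shows "real_polynomial_function (\<lambda>\<tau>. coeff (jet (B \<tau>) k q) d)"
proof (induction k arbitrary: q d)
  case 0
  then show ?case by (simp add: real_polynomial_function.intros(2))
next
  case (Suc k)
  show ?case
  proof (cases "product_core q")
    case True
    then show ?thesis
      by (simp add: coeff_mult coeff_sum)
        (intro real_polynomial_function_sum real_polynomial_function.intros(4) B Suc finite_atMost finite)
  next
    case False
    then show ?thesis by (simp add: real_polynomial_function.intros(2))
  qed
qed

text \<open>Pick a basis \<open>X\<close> of \<open>\<real>\<^sup>p\<close> from the curve and expand each slice in it. This accounts for \<open>p\<close> rank one
  terms. Each of them has base entry \<open>1\<close>, so the base entries come out wrong, and the last
  term, supported on the base position, corrects them.\<close>

lemma rank_decomposition_of_span:
  fixes T :: "real^'m^'p^'n"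
  assumes B: "graph_coeffs B"
    and T: "\<And>i j k. (i, k) \<noteq> (i0, j0) \<Longrightarrow> T $ i $ j $ k = entry B i k (v j)"
    and span: "span {w t | t. step B t (w t) = w t} = UNIV"
  shows "rank_decomposition T (CARD('p) + 1)"
proof -
  define S where "S = {w t | t. step B t (w t) = w t}"
  obtain X where X: "X \<subseteq> S" "independent X" "S \<subseteq> span X" "card X = dim S"
    by (rule basis_exists)
  have "dim S = CARD('p)" using span dim_span[of S] by (simp add: S_def)
  then have card: "card X = CARD('p)" using X by simp
  have fin: "finite X" using card card.infinite by fastforce
  have "span X = UNIV" using X(3) span by (metis S_def span_mono span_span top.extremum_uniqueI)
  then have "\<exists>r. v j = (\<Sum>x\<in>X. r x *\<^sub>R x)" for j
    using span_finite[OF fin] by (metis (no_types, lifting) UNIV_I imageE)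
  then obtain r where r: "\<And>j. v j = (\<Sum>x\<in>X. r j x *\<^sub>R x)" by metis
  obtain h where h: "bij_betw h {..<CARD('p)} X"
    using ex_bij_betw_nat_finite[OF fin] card by (auto simp: atLeast0LessThan)
  define a where "a l = (if l < CARD('p) then rank_one_row B (h l) else axis i0 1)" for l
  define b :: "nat \<Rightarrow> real^'p" where "b l = (if l < CARD('p) then \<chi> j. r j (h l)
    else \<chi> j. T $ i0 $ j $ j0 - (\<Sum>x\<in>X. r j x))" for l
  define c where "c l = (if l < CARD('p) then rank_one_col B (h l) else axis j0 1)" for l
  have "T = (\<Sum>l<CARD('p) + 1. tensor_prod3 (a l) (b l) (c l))"
  proof (intro vec_eq_iff[THEN iffD2] allI)
    fix i j k
    have "(\<Sum>l<CARD('p). a l $ i * b l $ j * c l $ k)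
        = (\<Sum>l<CARD('p). r j (h l) * (rank_one_row B (h l) $ i * rank_one_col B (h l) $ k))"
      by (simp add: a_def b_def c_def mult_ac)
    also have "\<dots> = (\<Sum>x\<in>X. r j x * (rank_one_row B x $ i * rank_one_col B x $ k))"
      by (rule sum.reindex_bij_betw[OF h])
    also have "\<dots> = (\<Sum>x\<in>X. r j x * (of_bool (i = i0 \<and> k = j0) + entry B i k x))"
    proof (rule sum.cong)
      fix x assume "x \<in> X"
      then obtain t where "step B t x = x" using X(1) by (auto simp: S_def)
      then show "r j x * (rank_one_row B x $ i * rank_one_col B x $ k) =
          r j x * (of_bool (i = i0 \<and> k = j0) + entry B i k x)"
        by (simp only: rank_one_entry[OF B])
    qed simp
    also have "\<dots> = (\<Sum>x\<in>X. r j x) * of_bool (i = i0 \<and> k = j0) + entry B i k (v j)"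
      by (simp add: distrib_left sum.distrib sum_distrib_right r linear_sum[OF linear_entry]
          linear_scale[OF linear_entry])
    finally have "(\<Sum>l<CARD('p) + 1. tensor_prod3 (a l) (b l) (c l)) $ i $ j $ k =
        (\<Sum>x\<in>X. r j x) * of_bool (i = i0 \<and> k = j0) + entry B i k (v j) +
        axis i0 1 $ i * (T $ i0 $ j $ j0 - (\<Sum>x\<in>X. r j x)) * axis j0 1 $ k"
      by (simp add: tensor_prod3_def a_def b_def c_def)
    also have "\<dots> = T $ i $ j $ k"
      using T[of i k j] entry_base[OF B] by (cases "(i, k) = (i0, j0)") (auto simp: axis_def)
    finally show "T $ i $ j $ k = (\<Sum>l<CARD('p) + 1. tensor_prod3 (a l) (b l) (c l)) $ i $ j $ k" ..
  qed
  then show ?thesis unfolding rank_decomposition_def by blast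
qed

text \<open>Once the \<open>p \<times> p\<close> matrix of core entries of the slices is invertible, its inverse yields the graph
  coefficients. Moving that matrix towards the identity makes it invertible, except at the finitely many roots
  of a polynomial.\<close>

lemma tensor_near_in_graph:
  fixes T :: "real^'m^'p^'n"
  assumes "open U" "T \<in> U"
  obtains T' B v where "T' \<in> U" "graph_coeffs B"
    "\<And>i j k. (i, k) \<noteq> (i0, j0) \<Longrightarrow> T' $ i $ j $ k = entry B i k (v j)"
proof -
  define core :: "real^'m^'p^'n \<Rightarrow> real^'p^'p"
    where "core T = (\<chi> j q. T $ fst (\<sigma> q) $ j $ snd (\<sigma> q))" for T
  \<comment> \<open>the direction that moves the core matrix towards the identity and fixes the other entries\<close>
  define Z :: "real^'m^'p^'n"
    where "Z = (\<chi> i j k. \<Sum>q\<in>UNIV. of_bool (\<sigma> q = (i, k)) * (mat 1 - core T) $ j $ q)"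
  have sigma: "\<sigma> q = \<sigma> q' \<longleftrightarrow> q = q'" for q q'
    using inj_exponent by (auto simp: inj_def)
  have core: "core (T + \<epsilon> *\<^sub>R Z) = core T + \<epsilon> *\<^sub>R (mat 1 - core T)" for \<epsilon>
    by (simp add: vec_eq_iff Z_def core_def sigma)
  have "real_polynomial_function (\<lambda>\<epsilon>. det (core (T + \<epsilon> *\<^sub>R Z)))"
    unfolding core
    by (rule real_polynomial_function_det) (simp add: real_polynomial_function_affine)
  moreover have "det (core (T + 1 *\<^sub>R Z)) \<noteq> 0" unfolding core by simp
  moreover obtain \<delta> where "\<delta> > 0" and \<delta>: "\<And>\<epsilon>. 0 < \<epsilon> \<Longrightarrow> \<epsilon> < \<delta> \<Longrightarrow> T + \<epsilon> *\<^sub>R Z \<in> U"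
    using line_stays_in_open[OF assms] by blast
  ultimately obtain \<epsilon> where eps: "0 < \<epsilon>" "\<epsilon> < \<delta>" "det (core (T + \<epsilon> *\<^sub>R Z)) \<noteq> 0"
    using real_polynomial_function_nonzero_near_0 by blast
  define T' where "T' = T + \<epsilon> *\<^sub>R Z"
  have "invertible (core T')" using eps(3) by (simp add: T'_def invertible_det_nz)
  then obtain N where N: "core T' ** N = mat 1" "N ** core T' = mat 1"
    unfolding invertible_def by blast
  define B where "B i k q = (if (i, k) = (i0, j0) then 0 else \<Sum>j\<in>UNIV. N $ q $ j * T' $ i $ j $ k)" for i k q
  show thesis
  proof
    show "T' \<in> U" using \<delta> eps by (simp add: T'_def)
    show "graph_coeffs B"
      unfolding graph_coeffs_def
    proof (intro conjI allI)
      fix q q'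
      have "(fst (\<sigma> q), snd (\<sigma> q)) \<noteq> (i0, j0)" using base_position by (metis prod.collapse rangeI)
      then have "B (fst (\<sigma> q)) (snd (\<sigma> q)) q' = (N ** core T') $ q' $ q"
        by (auto simp: B_def matrix_matrix_mult_def core_def)
      then show "B (fst (\<sigma> q)) (snd (\<sigma> q)) q' = of_bool (q = q')"
        by (auto simp: N mat_def)
    qed (simp add: B_def)
    show "T' $ i $ j $ k = entry B i k (core T' $ j)" if "(i, k) \<noteq> (i0, j0)" for i j k
    proof -
      have "entry B i k (core T' $ j) = (\<Sum>q\<in>UNIV. \<Sum>j'\<in>UNIV. core T' $ j $ q * N $ q $ j' * T' $ i $ j' $ k)"
        using that by (auto simp: entry_def B_def sum_distrib_left mult_ac intro!: sum.cong)
      also have "\<dots> = (\<Sum>j'\<in>UNIV. \<Sum>q\<in>UNIV. core T' $ j $ q * N $ q $ j' * T' $ i $ j' $ k)"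
        by (rule sum.swap)
      also have "\<dots> = (\<Sum>j'\<in>UNIV. (core T' ** N) $ j $ j' * T' $ i $ j' $ k)"
        by (simp add: matrix_matrix_mult_def sum_distrib_right)
      also have "\<dots> = T' $ i $ j $ k"
        by (simp add: N mat_def if_distrib[where f = "\<lambda>x. x * _"] cong: if_cong)
      finally show ?thesis ..
    qed
  qed
qed

text \<open>Keep the core entries of the slices and move the graph coefficients slightly towards those of the
  monomial curve. The other entries then depend affinely on the parameter, so the tensor stays in \<open>U\<close>.\<close>

lemma rank_decomposition_near:
  fixes U :: "(real^'m^'p^'n) set"
  assumes "open U" "U \<noteq> {}"
  shows "\<exists>T\<in>U. rank_decomposition T (CARD('p) + 1)"
proof -
  obtain T B v where T: "T \<in> U" and B: "graph_coeffs B"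
    and T_entry: "\<And>i j k. (i, k) \<noteq> (i0, j0) \<Longrightarrow> T $ i $ j $ k = entry B i k (v j)"
    using assms tensor_near_in_graph[of U] by (metis equals0I)
  define C where "C \<tau> i k q = B i k q + \<tau> * (monomial_coeffs i k q - B i k q)" for \<tau> i k q
  have C: "graph_coeffs (C \<tau>)" for \<tau>
    using B graph_coeffs_monomial by (simp add: graph_coeffs_def C_def)
  have entry_C: "entry (C \<tau>) i k w = entry B i k w + \<tau> * (entry monomial_coeffs i k w - entry B i k w)" for \<tau> i k w
    by (simp add: entry_def C_def algebra_simps sum.distrib sum_subtractf sum_distrib_left)
  define Z :: "real^'m^'p^'n" where "Z = (\<chi> i j k. entry monomial_coeffs i k (v j) - entry B i k (v j))"
  obtain \<delta> where "\<delta> > 0" and \<delta>: "\<And>\<tau>. 0 < \<tau> \<Longrightarrow> \<tau> < \<delta> \<Longrightarrow> T + \<tau> *\<^sub>R Z \<in> U"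
    using line_stays_in_open[OF assms(1) T] by blast
  moreover have "real_polynomial_function (\<lambda>\<tau>. C \<tau> i k q)" for i k q
    unfolding C_def by (rule real_polynomial_function_affine)
  then have "real_polynomial_function (\<lambda>\<tau>. det (jet_matrix (C \<tau>)))"
    by (intro real_polynomial_function_det) (simp add: jet_matrix_def real_polynomial_function_coeff_jet)
  moreover have "C 1 = monomial_coeffs" by (simp add: C_def fun_eq_iff)
  then have "det (jet_matrix (C 1)) \<noteq> 0" by (simp add: jet_matrix_monomial)
  ultimately obtain \<tau> where tau: "0 < \<tau>" "\<tau> < \<delta>" "det (jet_matrix (C \<tau>)) \<noteq> 0"
    using real_polynomial_function_nonzero_near_0 by blast
  obtain w where "solution_curve (C \<tau>) w" using solution_curve_exists by blast
  from span_solution_curve[OF this tau(3)]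
  have "rank_decomposition (T + \<tau> *\<^sub>R Z) (CARD('p) + 1)"
    by (intro rank_decomposition_of_span[OF C]) (auto simp: T_entry entry_C Z_def)
  then show ?thesis using \<delta> tau by blast
qed

end

section \<open>Typical ranks\<close>

theorem theorem8p1:
  fixes r :: nat
  assumes "3 \<le> CARD('m::finite)"
    and "CARD('m) \<le> CARD('n::finite)"
    and "(CARD('m) - 1) * (CARD('n) - 1) + 1 \<le> CARD('p::finite)"
    and "CARD('p) \<le> (CARD('m) - 1) * CARD('n)"
    and "typical_rank TYPE(real^'m^'p^'n) r"
  shows "r \<le> CARD('p) + 1"
proof -
  obtain \<sigma> :: "'p \<Rightarrow> 'n \<times> 'm" and \<alpha> \<beta> i0 j0 where "monomial_curve \<sigma> \<alpha> \<beta> i0 j0"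
    using monomial_curve_exists[OF assms(3,4)] assms(1,2) by auto
  then interpret monomial_curve \<sigma> \<alpha> \<beta> i0 j0 .
  obtain U :: "(real^'m^'p^'n) set" where U: "open U" "U \<noteq> {}" "U \<subseteq> {T. tensor_rank T = r}"
    using assms(5) by (auto simp: typical_rank_def)
  obtain T where T: "T \<in> U" "rank_decomposition T (CARD('p) + 1)"
    using rank_decomposition_near[OF U(1,2)] by blast
  then have "tensor_rank T \<le> CARD('p) + 1"
    unfolding tensor_rank_def by (intro Least_le)
  then show ?thesis using T(1) U(3) by auto
qed

end
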